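(* Let $k$ be a fixed positive integer and $x\ne0$ a fixed real number. Then, as $\rho\to+\infty$, $${}_1\Psi_1(\rho,k;\rho,0;x)=\rho^k e^x\sum_{n=0}^{k-1}x^{k-n}\left\{S_k^{(k-n)}+\frac{k(k-1)}{2\rho}\,S_{k-1}^{(k-n)}+O(\rho^{-2})\right\}.$$
   Context: For a positive integer $k$, real $\rho>0$ and real $x$, ${}_1\Psi_1(\rho,k;\rho,0;x)=\sum_{n=0}^\infty \frac{\Gamma(k+\rho n)}{\Gamma(\rho n)}\frac{x^n}{n!}$, where the term $n=0$ is $0$ (since $1/\Gamma(0)=0$ and $k\geq 1$). $S_m^{(r)}$ denotes the Stirling numbers of the second kind, defined by $y^m=\sum_{r=0}^m S_m^{(r)}\,y(y-1)\cdots(y-r+1)$, with $S_m^{(r)}=0$ if $r>m$. *)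

theory Defs
  imports "HOL-Analysis.Gamma_Function" "HOL-Library.Landau_Symbols"
    "HOL-Combinatorics.Stirling"
begin

text \<open>
  The Wright function \<open>\<^sub>1\<Psi>\<^sub>1(\<alpha>, a; \<beta>, b; x)\<close>. The factor \<open>rGamma\<close> is the entire function
  \<open>1 / \<Gamma>\<close>, which vanishes at the nonpositive integers; so for \<open>b = 0\<close> the term with
  \<open>n = 0\<close> is \<open>0\<close>. The definition is meant only for parameters such that
  no \<open>\<alpha> n + a\<close> is a pole of \<open>\<Gamma>\<close>.
\<close>

definition wright_Psi :: "real \<Rightarrow> real \<Rightarrow> real \<Rightarrow> real \<Rightarrow> real \<Rightarrow> real" where
  "wright_Psi \<alpha> a \<beta> b x =
     (\<Sum>n. Gamma (a + \<alpha> * real n) * rGamma (b + \<beta> * real n) * x ^ n / fact n)"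

text \<open>The library defines \<open>Stirling\<close> by its recurrence; this is the expansion of powers in
  falling factorials that characterises the Stirling numbers of the second kind.\<close>

lemma power_eq_sum_Stirling:
  fixes y :: "'a :: comm_ring_1"
  shows "y ^ m = (\<Sum>r\<le>m. of_nat (Stirling m r) * (\<Prod>i<r. y - of_nat i))"
proof (induction m)
  case 0
  then show ?case by simp
next
  case (Suc m)
  define F where "F r = (\<Prod>i<r. y - of_nat i)" for r
  have F: "y * F r = F (Suc r) + of_nat r * F r" for r
    by (simp add: F_def algebra_simps)
  have shift: "(\<Sum>r\<le>m. of_nat r * of_nat (Stirling m r) * F r)
      = (\<Sum>r\<le>m. of_nat (Suc r) * of_nat (Stirling m (Suc r)) * F (Suc r))"
  proof -
    have "(\<Sum>r\<le>m. of_nat r * of_nat (Stirling m r) * F r)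
        = (\<Sum>r\<le>Suc m. of_nat r * of_nat (Stirling m r) * F r)"
      by simp
    also have "\<dots> = (\<Sum>r\<le>m. of_nat (Suc r) * of_nat (Stirling m (Suc r)) * F (Suc r))"
      by (subst sum.atMost_Suc_shift) simp
    finally show ?thesis .
  qed
  have "y ^ Suc m = (\<Sum>r\<le>m. of_nat (Stirling m r) * (y * F r))"
    by (simp add: Suc.IH F_def sum_distrib_left mult_ac)
  also have "\<dots> = (\<Sum>r\<le>m. of_nat (Stirling m r) * F (Suc r))
      + (\<Sum>r\<le>m. of_nat r * of_nat (Stirling m r) * F r)"
    by (simp add: F ring_distribs sum.distrib mult_ac)
  also have "\<dots> = (\<Sum>r\<le>m. of_nat (Stirling (Suc m) (Suc r)) * F (Suc r))"
    unfolding shift by (simp add: sum.distrib [symmetric] algebra_simps)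
  also have "\<dots> = (\<Sum>r\<le>Suc m. of_nat (Stirling (Suc m) r) * F r)"
    by (subst sum.atMost_Suc_shift) simp
  finally show ?case by (simp only: F_def)
qed

end

(* Since Gamma (k + y) / Gamma y is the rising factorial of y, expand it into powers of y = rho n
   with Stirling numbers of the first kind. The sums over n of n^m x^n / n! are Touchard
   polynomials times exp x, whose coefficients are the Stirling numbers of the second kind.
   So the Wright function is exp x times an exact polynomial in rho of degree k;
   its two leading terms are the stated ones, as stirling k (k - 1) = k choose 2. *)

theory Submission imports Defs begin

lemma prod_falling_mult_fact:
  "(\<Prod>i<r. of_nat (n + r) - of_nat i) * fact n = (fact (n + r) :: 'a :: {comm_ring_1, semiring_char_0})"
proof (induction r)
  case (Suc r)
  \<comment> \<open>The factor \<open>i = 0\<close> is split off rather than the last one: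
    reindexing the others lowers \<open>n + Suc r\<close> to \<open>n + r\<close>, which is the
    product in the induction hypothesis.\<close>
  have "(\<Prod>i<Suc r. of_nat (n + Suc r) - of_nat i) * (fact n :: 'a)
      = of_nat (n + Suc r) * ((\<Prod>i<r. of_nat (n + r) - of_nat i) * fact n)"
    by (subst prod.lessThan_Suc_shift) (simp add: mult.assoc)
  also have "\<dots> = fact (n + Suc r)"
    by (simp only: Suc.IH add_Suc_right fact_Suc)
  finally show ?case .
qed simp

text \<open>The terms with \<open>n < r\<close> contain a zero factor. From \<open>n = r\<close> on,
  the falling factorial cancels against \<open>fact n\<close> and leaves the exponential series
  multiplied by \<open>x ^ r\<close>.\<close>

lemma falling_factorial_sums_exp:
  fixes x :: real
  shows "(\<lambda>n. (\<Prod>i<r. real n - real i) * x ^ n / fact n) sums (x ^ r * exp x)"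
proof -
  let ?f = "\<lambda>n. (\<Prod>i<r. real n - real i) * x ^ n / fact n"
  have shifted: "?f (n + r) = x ^ r * (x ^ n /\<^sub>R fact n)" for n
  proof -
    have "(\<Prod>i<r. real (n + r) - real i) / fact (n + r) = 1 / fact n"
      using prod_falling_mult_fact [of n r, where 'a = real]
      by (simp add: divide_simps del: of_nat_add)
    then show ?thesis
      by (simp add: power_add field_simps)
  qed
  have "(\<lambda>n. ?f (n + r)) sums (x ^ r * exp x)"
    unfolding shifted by (intro sums_mult exp_converges)
  moreover have "(\<Sum>n<r. ?f n) = 0"
    by (intro sum.neutral ballI) (auto intro!: prod_zero)
  ultimately show ?thesis
    using sums_iff_shift' [of ?f r "x ^ r * exp x"] by simp
qed

text \<open>Expanding \<open>real n ^ m\<close> in falling factorials reduces this to finitely many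
  exponential series, added termwise.\<close>

lemma power_sums_Touchard:
  fixes x :: real
  shows "(\<lambda>n. real n ^ m * x ^ n / fact n) sums
    (exp x * (\<Sum>r\<le>m. real (Stirling m r) * x ^ r))"
proof -
  have "(\<lambda>n. \<Sum>r\<le>m. real (Stirling m r) * ((\<Prod>i<r. real n - real i) * x ^ n / fact n)) sums
      (\<Sum>r\<le>m. real (Stirling m r) * (x ^ r * exp x))"
    by (intro sums_sum sums_mult falling_factorial_sums_exp)
  also have "(\<lambda>n. \<Sum>r\<le>m. real (Stirling m r) * ((\<Prod>i<r. real n - real i) * x ^ n / fact n)) =
      (\<lambda>n. real n ^ m * x ^ n / fact n)"
    by (simp add: power_eq_sum_Stirling [of "real _" m] sum_distrib_right sum_divide_distrib
        mult.assoc)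
  finally show ?thesis
    by (simp add: sum_distrib_left mult_ac)
qed

lemma wright_Psi_eq_Stirling_sum:
  fixes x \<rho> :: real
  assumes "k \<ge> 1" "\<rho> > 0"
  shows "wright_Psi \<rho> (real k) \<rho> 0 x =
    exp x * (\<Sum>m\<le>k. \<Sum>r\<le>k. real (stirling k m) * \<rho> ^ m * real (Stirling m r) * x ^ r)"
proof -
  \<comment> \<open>At \<open>n = 0\<close> both sides vanish: the left because
    \<open>rGamma 0 = 0\<close>, the right because the rising factorial of 0 has a zero factor when
    \<open>k \<ge> 1\<close>.\<close>
  have "Gamma (real k + \<rho> * real n) * rGamma (0 + \<rho> * real n) = pochhammer (\<rho> * real n) k" for n
  proof (cases "n = 0")
    case True
    then show ?thesis
      using assms by (simp add: pochhammer_0_left)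
  next
    case False
    then have "\<rho> * real n > 0"
      using assms by simp
    then have "\<rho> * real n \<notin> \<int>\<^sub>\<le>\<^sub>0"
      by auto
    then show ?thesis
      by (simp add: pochhammer_Gamma rGamma_inverse_Gamma add.commute divide_inverse)
  qed
  then have "wright_Psi \<rho> (real k) \<rho> 0 x = (\<Sum>n. pochhammer (\<rho> * real n) k * x ^ n / fact n)"
    by (simp add: wright_Psi_def)
  also have "\<dots> = (\<Sum>n. \<Sum>m\<le>k. real (stirling k m) * \<rho> ^ m * (real n ^ m * x ^ n / fact n))"
    by (simp add: stirling_pochhammer [symmetric] sum_distrib_left sum_distrib_right
        sum_divide_distrib power_mult_distrib mult_ac)
  also have "\<dots> = (\<Sum>m\<le>k. real (stirling k m) * \<rho> ^ m *
      (exp x * (\<Sum>r\<le>m. real (Stirling m r) * x ^ r)))"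
    by (intro sums_unique [symmetric] sums_sum sums_mult power_sums_Touchard)
  \<comment> \<open>Since \<open>Stirling m r = 0\<close> for \<open>r > m\<close>, the inner range
    can be made independent of \<open>m\<close>, so that the two sums can later be
    interchanged.\<close>
  also have "\<dots> = (\<Sum>m\<le>k. real (stirling k m) * \<rho> ^ m *
      (exp x * (\<Sum>r\<le>k. real (Stirling m r) * x ^ r)))"
  proof (intro sum.cong refl)
    fix m assume "m \<in> {..k}"
    then have "(\<Sum>r\<le>m. real (Stirling m r) * x ^ r) = (\<Sum>r\<le>k. real (Stirling m r) * x ^ r)"
      by (intro sum.mono_neutral_left) auto
    then show "real (stirling k m) * \<rho> ^ m * (exp x * (\<Sum>r\<le>m. real (Stirling m r) * x ^ r)) =
        real (stirling k m) * \<rho> ^ m * (exp x * (\<Sum>r\<le>k. real (Stirling m r) * x ^ r))"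
      by simp
  qed
  finally show ?thesis
    by (simp add: sum_distrib_left mult_ac)
qed

text \<open>The terms \<open>m = k\<close> and \<open>m = k - 1\<close> are isolated, using
  \<open>stirling k k = 1\<close> and \<open>stirling k (k - 1) = k choose 2\<close>. Dividing by
  \<open>\<rho> ^ k\<close> leaves only inverse powers with exponent \<open>k - m \<ge> 2\<close> in
  the remaining sum.\<close>

lemma sum_stirling_Stirling_leading_terms:
  fixes \<rho> :: real
  assumes "k \<ge> 1" "\<rho> > 0"
  shows "(\<Sum>m\<le>k. real (stirling k m) * \<rho> ^ m * real (Stirling m r)) =
    \<rho> ^ k * (real (Stirling k r) + real k * (real k - 1) / (2 * \<rho>) * real (Stirling (k - 1) r)
      + (\<Sum>m<k - 1. real (stirling k m) * real (Stirling m r) / \<rho> ^ (k - m)))"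
proof -
  obtain j where k: "k = Suc j"
    using assms by (cases k) auto
  have choose: "real (Suc j choose 2) = real k * (real k - 1) / 2"
    by (simp add: k choose_two real_of_nat_div algebra_simps)
  have quotient: "\<rho> ^ m = \<rho> ^ k / \<rho> ^ (k - m)" if "m < j" for m
    using that assms k by (simp add: power_diff)
  have "(\<Sum>m<j. real (stirling k m) * \<rho> ^ m * real (Stirling m r)) =
      \<rho> ^ k * (\<Sum>m<j. real (stirling k m) * real (Stirling m r) / \<rho> ^ (k - m))"
    unfolding sum_distrib_left
    by (intro sum.cong refl) (subst quotient, auto)
  moreover have "(\<Sum>m\<le>k. real (stirling k m) * \<rho> ^ m * real (Stirling m r)) =
      (\<Sum>m<j. real (stirling k m) * \<rho> ^ m * real (Stirling m r))
      + real (Suc j choose 2) * \<rho> ^ j * real (Stirling j r) + \<rho> ^ k * real (Stirling k r)"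
    unfolding k
    by (simp only: sum.atMost_Suc stirling_Suc_n_n stirling_same lessThan_Suc_atMost [symmetric]
        sum.lessThan_Suc of_nat_1 mult_1)
  ultimately show ?thesis
    using assms unfolding choose by (simp add: k field_simps)
qed

lemma inverse_power_bigo_inverse_square:
  assumes "p \<ge> 2"
  shows "(\<lambda>\<rho>::real. c / \<rho> ^ p) \<in> O[at_top](\<lambda>\<rho>. 1 / \<rho> ^ 2)"
proof (rule bigoI [where c = "\<bar>c\<bar>"])
  show "\<forall>\<^sub>F \<rho>::real in at_top. norm (c / \<rho> ^ p) \<le> \<bar>c\<bar> * norm (1 / \<rho> ^ 2)"
    \<comment> \<open>For \<open>\<rho> \<ge> 1\<close>, powers of \<open>\<rho>\<close> increase
      with the exponent.\<close>
    using eventually_ge_at_top [of 1]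
  proof eventually_elim
    case (elim \<rho>)
    then have "\<rho> ^ 2 \<le> \<rho> ^ p"
      using assms by (intro power_increasing) auto
    then have "\<bar>c\<bar> / \<rho> ^ p \<le> \<bar>c\<bar> / \<rho> ^ 2"
      using elim by (intro divide_left_mono) auto
    then show ?case
      using elim by simp
  qed
qed

theorem mainTheorem5:
  fixes k :: nat and x :: real
  assumes "k \<ge> 1" and "x \<noteq> 0"
  shows "\<exists>E :: nat \<Rightarrow> real \<Rightarrow> real.
    (\<forall>n<k. E n \<in> O[at_top](\<lambda>\<rho>. 1 / \<rho> ^ 2)) \<and>
    (\<forall>\<^sub>F \<rho> in at_top.
       wright_Psi \<rho> (real k) \<rho> 0 x =
         \<rho> ^ k * exp x *
         (\<Sum>n=0..k-1. x ^ (k - n) *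
            (real (Stirling k (k - n))
             + real k * (real k - 1) / (2 * \<rho>) * real (Stirling (k - 1) (k - n))
             + E n \<rho>)))"
proof -
  \<comment> \<open>The error is the exact remainder, a polynomial in \<open>1 / \<rho>\<close>
    without terms of degree below 2, so the expansion is an identity for every
    \<open>\<rho> > 0\<close>. For \<open>k = 1\<close> and \<open>k = 0\<close> alike the sum is
    empty.\<close>
  define E where "E n \<rho> = (\<Sum>m<k - 1. real (stirling k m) * real (Stirling m (k - n)) / \<rho> ^ (k - m))"
    for n :: nat and \<rho> :: real
  have "E n \<in> O[at_top](\<lambda>\<rho>. 1 / \<rho> ^ 2)" for n
    unfolding E_def by (intro big_sum_in_bigo inverse_power_bigo_inverse_square) auto
  moreover have "\<forall>\<^sub>F \<rho> in at_top. wright_Psi \<rho> (real k) \<rho> 0 x =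
      \<rho> ^ k * exp x * (\<Sum>n=0..k-1. x ^ (k - n) *
        (real (Stirling k (k - n))
         + real k * (real k - 1) / (2 * \<rho>) * real (Stirling (k - 1) (k - n)) + E n \<rho>))"
    using eventually_gt_at_top [of 0]
  proof eventually_elim
    case (elim \<rho>)
    define T where "T r = (\<Sum>m\<le>k. real (stirling k m) * \<rho> ^ m * real (Stirling m r))" for r
    \<comment> \<open>The power \<open>x ^ 0\<close> does not occur: \<open>stirling k 0 = 0\<close>
      because \<open>k \<ge> 1\<close>, and \<open>Stirling m 0 = 0\<close> for
      \<open>m > 0\<close>. This leaves \<open>r\<close> from 1 to \<open>k\<close>, matching
      \<open>r = k - n\<close> with \<open>n\<close> from 0 to \<open>k - 1\<close>.\<close>
    have "real (stirling k m) * \<rho> ^ m * real (Stirling m 0) = 0" for m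
      using assms by (cases m) auto
    then have "T 0 = 0"
      unfolding T_def by (intro sum.neutral ballI)
    have "wright_Psi \<rho> (real k) \<rho> 0 x = exp x * (\<Sum>r\<le>k. x ^ r * T r)"
      unfolding wright_Psi_eq_Stirling_sum [OF assms(1) elim] T_def sum_distrib_left
      by (subst sum.swap) (simp add: mult_ac)
    also have "(\<Sum>r\<le>k. x ^ r * T r) = (\<Sum>r\<in>{1..k}. x ^ r * T r)"
      using \<open>T 0 = 0\<close> by (intro sum.mono_neutral_right) (auto simp: not_le)
    also have "\<dots> = (\<Sum>n=0..k-1. x ^ (k - n) * T (k - n))"
      using assms by (intro sum.reindex_bij_witness [of _ "\<lambda>n. k - n" "\<lambda>r. k - r"]) auto
    finally show ?case
      unfolding T_def E_def sum_stirling_Stirling_leading_terms [OF assms(1) elim]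
      by (simp only: sum_distrib_left mult_ac)
  qed
  ultimately show ?thesis
    by blast
qed

end
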